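(* Let $G=(V,E)$ be a connected graph with $|V|=n\ge 2$. Run the Lipschitz learning dynamics on $G$ starting with an initial profile $f_0:V\to[0,1]$, where the update vertices $\{v_t\}$ are chosen in round robin fashion, that is, opinions are updated at vertices selected according to a fixed cyclic permutation of $V$. Then for every $0<\epsilon<1$, $$\tau_\infty(\epsilon)\le n\,(\mathrm{Diam}(G)+1)^2\log\frac{2}{\epsilon}.$$
   Context: All graphs are finite, undirected and simple. $\mathrm{Diam}(G)$ is the diameter in the graph distance. Lipschitz learning dynamics with update vertices $v_1,v_2,\ldots\in V$: for $t\ge 1$, $f_t(v_t)=\frac12\bigl(\max_{u\sim v_t}f_{t-1}(u)+\min_{w\sim v_t}f_{t-1}(w)\bigr)$ and $f_t(v)=f_{t-1}(v)$ for $v\ne v_t$. Round robin means $v_1,\dots,v_n$ is an enumeration of $V$ and $v_{t+n}=v_t$ for all $t\ge1$. The oscillation is $\mathfrak{osc}(f)=\max_v f(v)-\min_w f(w)$, and $\tau_\infty(\epsilon)=\min\{t\ge 0:\ \mathfrak{osc}(f_t)\le\epsilon\}$. *)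

theory Defs
  imports Complex_Main "Graph_Theory.Shortest_Path" "Graph_Theory.Digraph_Component"
begin

text \<open>
  A finite simple undirected graph is a locale-\<open>graph\<close> digraph: finite, loopfree, without
  parallel arcs, and with every arc accompanied by its reverse.
\<close>

definition graph_dist :: "('a, 'b) pre_digraph \<Rightarrow> 'a \<Rightarrow> 'a \<Rightarrow> ereal" where
  "graph_dist G u v = wf_digraph.\<mu> G (\<lambda>_. 1) u v"

text \<open>
  On a connected graph all distances are finite, so the conversion to \<^typ>\<open>real\<close> loses nothing;
  on a disconnected graph the value is the junk value 0.
\<close>

definition graph_diam :: "('a, 'b) pre_digraph \<Rightarrow> real" where
  "graph_diam G = real_of_ereal (Max {graph_dist G u v | u v. u \<in> verts G \<and> v \<in> verts G})"

text \<open>Update vertices are indexed from 1, so \<open>v 0\<close> is never used.\<close>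

primrec lipschitz_learning ::
  "('a, 'b) pre_digraph \<Rightarrow> (nat \<Rightarrow> 'a) \<Rightarrow> ('a \<Rightarrow> real) \<Rightarrow> nat \<Rightarrow> 'a \<Rightarrow> real" where
  "lipschitz_learning G v f\<^sub>0 0 = f\<^sub>0"
| "lipschitz_learning G v f\<^sub>0 (Suc t) =
    (let f = lipschitz_learning G v f\<^sub>0 t; x = v (Suc t)
     in f(x := (Max (f ` {u. x \<rightarrow>\<^bsub>G\<^esub> u}) + Min (f ` {w. x \<rightarrow>\<^bsub>G\<^esub> w})) / 2))"

definition round_robin :: "('a, 'b) pre_digraph \<Rightarrow> (nat \<Rightarrow> 'a) \<Rightarrow> bool" where
  "round_robin G v \<longleftrightarrow>
     bij_betw v {1..card (verts G)} (verts G) \<and> (\<forall>t\<ge>1. v (t + card (verts G)) = v t)"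

definition oscillation :: "('a, 'b) pre_digraph \<Rightarrow> ('a \<Rightarrow> real) \<Rightarrow> real" where
  "oscillation G f = Max (f ` verts G) - Min (f ` verts G)"

text \<open>The value is \<open>\<infinity>\<close> if the oscillation never drops to \<open>\<epsilon>\<close>.\<close>

definition tau_infty ::
  "('a, 'b) pre_digraph \<Rightarrow> (nat \<Rightarrow> 'a) \<Rightarrow> ('a \<Rightarrow> real) \<Rightarrow> real \<Rightarrow> enat" where
  "tau_infty G v f\<^sub>0 \<epsilon> =
     (INF t \<in> {t. oscillation G (lipschitz_learning G v f\<^sub>0 t) \<le> \<epsilon>}. enat t)"

end

theory Submission
  imports Defs "HOL-Analysis.Complex_Transcendental"
begin

text \<open>
  Two-point estimates: if \<open>\<bar>f x - f y\<bar> \<le> w (d x y)\<close> for all pairs, then updating \<open>x\<close> gives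
  \<open>\<bar>f x - f y\<bar> \<le> (w (k - 1) + w (k + 1)) / 2\<close> with \<open>k = d x y\<close>, because one neighbour of \<open>x\<close> is
  closer to \<open>y\<close> and the others are at distance at most \<open>k + 1\<close>. In each round every pair is improved,
  so after \<open>r\<close> rounds the oscillation is at most the probability that simple random walk on
  \<open>{0..D}\<close>, started at \<open>D\<close>, held at \<open>D\<close> when it tries to leave and killed at 0, survives \<open>r\<close> steps.
  That probability is concave in the starting point; pairing it with the principal eigenfunction
  \<open>k \<mapsto> sin (\<theta> k)\<close>, \<open>\<theta> = \<pi> / (2 D + 1)\<close>, bounds it by \<open>2 D sin (\<theta> / 2) (cos \<theta>)^r\<close>.
\<close>

section \<open>Survival probabilities of the killed walk\<close>

primrec survival :: "nat \<Rightarrow> nat \<Rightarrow> nat \<Rightarrow> real" where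
  "survival D 0 k = (if k = 0 then 0 else 1)"
| "survival D (Suc r) k =
     (if k = 0 then 0 else (survival D r (k - 1) + survival D r (min (k + 1) D)) / 2)"

lemma survival_zero [simp]: "survival D r 0 = 0"
  by (cases r) auto

lemma survival_nonneg: "0 \<le> survival D r k"
  by (induction r arbitrary: k) auto

lemma survival_mono: "k \<le> l \<Longrightarrow> survival D r k \<le> survival D r l"
proof (induction r arbitrary: k l)
  case (Suc r)
  have "survival D r (k - 1) \<le> survival D r (l - 1)"
    and "survival D r (min (k + 1) D) \<le> survival D r (min (l + 1) D)"
    using Suc.prems by (auto intro!: Suc.IH)
  then show ?case
    using Suc.prems survival_nonneg[of D r] by (auto simp: add_mono)
qed auto

text \<open>The averaging operator is monotone, so the comparison at \<open>r = 0\<close>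
  propagates. Combined with the recursion this makes \<open>survival D r\<close> superharmonic,
  which is where concavity comes from.\<close>

lemma survival_Suc_le: "survival D (Suc r) k \<le> survival D r k"
proof (induction r arbitrary: k)
  case (Suc r)
  show ?case
  proof (cases "k = 0")
    case False
    then show ?thesis
      using Suc.IH[of "k - 1"] Suc.IH[of "min (k + 1) D"]
      by (simp only: survival.simps(2)[of D "Suc r"] survival.simps(2)[of D r k] if_False
          divide_right_mono add_mono zero_le_numeral)
  qed auto
qed auto

text \<open>Below \<open>D\<close> superharmonicity means concavity, and the value at 0 is 0, so the
  ratio of \<open>survival D r k\<close> to \<open>k\<close> cannot increase. The cross-multiplied
  form includes \<open>k = 0\<close>.\<close>

lemma survival_step_concave:
  assumes "k < D"
  shows "real k * survival D r (Suc k) \<le> real (Suc k) * survival D r k"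
  using assms
proof (induction k)
  case (Suc k)
  let ?w = "survival D r"
  have "?w k + ?w (Suc (Suc k)) \<le> 2 * ?w (Suc k)"
    using survival_Suc_le[of D r "Suc k"] Suc.prems by (simp add: min_def)
  then have "real (Suc k) * (?w k + ?w (Suc (Suc k))) \<le> real (Suc k) * (2 * ?w (Suc k))"
    by (intro mult_left_mono) auto
  with Suc show ?case
    by (simp add: algebra_simps)
qed auto

text \<open>The chord from the origin to the point at \<open>D\<close> lies below a concave
  function; the ratio inequality is chained downwards from \<open>D\<close>.\<close>

lemma survival_ge_chord:
  assumes "k \<le> D"
  shows "real k * survival D r D \<le> real D * survival D r k"
  using assms
proof (induction rule: inc_induct)
  case (step k)
  show ?case
  proof (cases "k = 0")
    case False
    have "real (Suc k) * (real k * survival D r D) = real k * (real (Suc k) * survival D r D)"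
      by simp
    also have "\<dots> \<le> real k * (real D * survival D r (Suc k))"
      using step.IH by (intro mult_left_mono) auto
    also have "\<dots> = real D * (real k * survival D r (Suc k))"
      by simp
    also have "\<dots> \<le> real D * (real (Suc k) * survival D r k)"
      using survival_step_concave[of k D r] step by (intro mult_left_mono) auto
    also have "\<dots> = real (Suc k) * (real D * survival D r k)"
      by simp
    finally show ?thesis
      by (subst (asm) mult_le_cancel_left_pos) auto
  qed auto
qed auto

section \<open>Spectral bound by the principal eigenfunction\<close>

lemma discrete_green:
  fixes a b :: "nat \<Rightarrow> real"
  shows "(\<Sum>k=1..D. (a (k - 1) + a (k + 1)) * b k) =
    (\<Sum>k=1..D. a k * (b (k - 1) + b (k + 1))) + a 0 * b 1 - a 1 * b 0 + a (D + 1) * b D - a D * b (D + 1)"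
  by (induction D) (auto simp: algebra_simps)

lemma sin_step: "sin (t * real k) + sin (t * (real k + 2)) = 2 * cos t * sin (t * (real k + 1))"
  using sin_add[of "t * (real k + 1)" t] sin_diff[of "t * (real k + 1)" t]
  by (simp add: algebra_simps)

text \<open>The chord bound is summed against the eigenfunction \<open>s\<close>. The sums of
  \<open>s k\<close> and of \<open>k * s k\<close> have ratio \<open>s 1\<close> to
  \<open>s D\<close>, which equals \<open>2 * sin (t / 2)\<close> and yields the prefactor.\<close>

lemma survival_le_cos_power:
  fixes D :: nat
  defines "t \<equiv> pi / (2 * D + 1)"
  assumes "D \<ge> 1"
  shows "survival D r D \<le> D * (2 * sin (t / 2)) * cos t ^ r"
proof -
  define s where "s k = sin (t * real k)" for k :: nat
  have step: "s (k - 1) + s (k + 1) = 2 * cos t * s k" if "k \<in> {1..D}" for k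
    using sin_step[of t "k - 1"] that by (simp add: s_def of_nat_diff algebra_simps)
  have sD: "s D = cos (t / 2)"
  proof -
    have "t * real D = pi / 2 - t / 2"
      by (simp add: t_def field_simps)
    then show ?thesis by (simp add: s_def sin_diff)
  qed
  \<comment> \<open>This symmetry of the sine about pi / 2 dictates the choice of \<open>t\<close>:
    it is the boundary condition for holding at \<open>D\<close>.\<close>
  have sD1: "s (D + 1) = s D"
  proof -
    have "t * real (D + 1) = pi - t * real D"
      by (simp add: t_def field_simps)
    then show ?thesis by (simp add: s_def)
  qed
  have t: "0 < t" "t \<le> pi / 3"
    using assms(2) by (auto simp: t_def field_simps)
  have s_nonneg: "0 \<le> s k" if "k \<in> {1..D}" for k
  proof -
    have "t * real k \<le> t * (2 * D + 1)"
      using that t by (intro mult_left_mono) auto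
    also have "\<dots> = pi"
      by (simp add: t_def)
    finally show ?thesis
      using t by (simp add: s_def sin_ge_zero)
  qed
  define c where "c = 1 - cos t"
  have c: "c > 0"
    using cos_monotone_0_pi[of 0 t] t by (simp add: c_def)
  \<comment> \<open>Self-adjointness of the averaging operator, up to the boundary terms.\<close>
  have green: "(\<Sum>k=1..D. (a (k - 1) + a (k + 1)) * s k) =
      2 * cos t * (\<Sum>k=1..D. a k * s k) + a 0 * s 1 + (a (D + 1) - a D) * s D" for a
  proof -
    have "(\<Sum>k=1..D. a k * (s (k - 1) + s (k + 1))) = 2 * cos t * (\<Sum>k=1..D. a k * s k)"
      unfolding sum_distrib_left by (intro sum.cong refl) (simp only: step mult_ac)
    with discrete_green[of a s D] show ?thesis
      by (simp only: sD1) (simp add: s_def algebra_simps)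
  qed
  \<comment> \<open>For a constant function only the boundary term at 0 remains.\<close>
  have sum1: "2 * c * (\<Sum>k=1..D. s k) = s 1"
  proof -
    have "(\<Sum>k=1..D. (1 + 1) * s k) = 2 * (\<Sum>k=1..D. s k)"
      by (simp add: sum_distrib_left)
    with green[of "\<lambda>_. 1"] show ?thesis
      by (simp add: c_def algebra_simps)
  qed
  \<comment> \<open>For the identity only the boundary term at \<open>D\<close> remains.\<close>
  have sumk: "2 * c * (\<Sum>k=1..D. real k * s k) = s D"
  proof -
    have "(\<Sum>k=1..D. (real (k - 1) + real (k + 1)) * s k) = 2 * (\<Sum>k=1..D. real k * s k)"
      unfolding sum_distrib_left by (intro sum.cong refl) (auto simp: of_nat_diff)
    with green[of real] show ?thesis
      by (simp add: c_def algebra_simps)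
  qed
  have sumw: "(\<Sum>k=1..D. survival D r k * s k) = cos t ^ r * (\<Sum>k=1..D. s k)"
  proof (induction r)
    case (Suc r)
    have "2 * (\<Sum>k=1..D. survival D (Suc r) k * s k) =
        (\<Sum>k=1..D. (survival D r (min (k - 1) D) + survival D r (min (k + 1) D)) * s k)"
      unfolding sum_distrib_left by (intro sum.cong refl) (auto simp: min_def)
    \<comment> \<open>The extension by \<open>min k D\<close> vanishes at 0 and is flat from
      \<open>D\<close> to \<open>D + 1\<close>, so both boundary terms of \<open>green\<close> are
      zero.\<close>
    also have "\<dots> = 2 * cos t * (\<Sum>k=1..D. survival D r (min k D) * s k)"
      using green[of "\<lambda>k. survival D r (min k D)"] by simp
    also have "(\<Sum>k=1..D. survival D r (min k D) * s k) = (\<Sum>k=1..D. survival D r k * s k)"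
      by (intro sum.cong) auto
    finally show ?case
      using Suc.IH by simp
  qed auto
  have "survival D r D * (\<Sum>k=1..D. real k * s k) = (\<Sum>k=1..D. (real k * survival D r D) * s k)"
    by (simp add: sum_distrib_left mult_ac)
  also have "\<dots> \<le> (\<Sum>k=1..D. (real D * survival D r k) * s k)"
    using s_nonneg by (intro sum_mono mult_right_mono survival_ge_chord) auto
  also have "\<dots> = D * (\<Sum>k=1..D. survival D r k * s k)"
    by (simp add: sum_distrib_left mult_ac)
  finally have "survival D r D * (\<Sum>k=1..D. real k * s k) \<le> D * (cos t ^ r * (\<Sum>k=1..D. s k))"
    unfolding sumw .
  then have "2 * c * (survival D r D * (\<Sum>k=1..D. real k * s k)) \<le> 2 * c * (D * (cos t ^ r * (\<Sum>k=1..D. s k)))"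
    using c by (intro mult_left_mono) auto
  also have "2 * c * (survival D r D * (\<Sum>k=1..D. real k * s k)) = survival D r D * s D"
    unfolding sumk[symmetric] by (simp add: mult_ac)
  also have "2 * c * (D * (cos t ^ r * (\<Sum>k=1..D. s k))) = D * cos t ^ r * s 1"
    unfolding sum1[symmetric] by (simp add: mult_ac)
  also have "s 1 = 2 * sin (t / 2) * s D"
    using sin_double[of "t / 2"] unfolding sD by (simp add: s_def)
  finally have "survival D r D * s D \<le> (D * (2 * sin (t / 2)) * cos t ^ r) * s D"
    by (simp add: mult_ac)
  moreover have "s D > 0"
    using t unfolding sD by (intro cos_gt_zero_pi) auto
  ultimately show ?thesis
    by (simp del: mult_le_cancel_right_pos add: mult_le_cancel_right)
qed

section \<open>From powers of the cosine to exponentials\<close>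

lemma cos_le_exp:
  fixes D :: nat
  assumes "D \<ge> 1"
  shows "cos (pi / (2 * D + 1)) \<le> exp (- 1 / (real D + 1)\<^sup>2)"
proof -
  \<comment> \<open>Half the angle: since \<open>cos (2 * p)\<close> is 1 - 2 sin^2 p, it suffices
    to bound sin p from below and then use 1 - x \<le> exp (- x).\<close>
  define p where "p = pi / (2 * (2 * real D + 1))"
  \<comment> \<open>The hypothesis \<open>D \<ge> 1\<close> gives p \<le> pi / 6 < 0.53.\<close>
  have p: "0 < p" "p \<le> 0.53"
    using assms pi_approx by (auto simp: p_def field_simps)
  have "\<bar>sin p - p\<bar> \<le> p ^ 3 / 6"
    using Maclaurin_sin_bound[of p 3] p
    by (simp add: sin_coeff_def eval_nat_numeral fact_numeral field_simps)
  then have "p * (1 - p\<^sup>2 / 6) \<le> sin p"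
    unfolding abs_le_iff by (simp add: power2_eq_square power3_eq_cube right_diff_distrib)
  moreover have "0.95 \<le> 1 - p\<^sup>2 / 6"
  proof -
    have "p\<^sup>2 \<le> 0.53\<^sup>2"
      using p by (intro power_mono) auto
    then show ?thesis by (simp add: power2_eq_square)
  qed
  ultimately have "p * 0.95 \<le> sin p"
    using p by (meson less_imp_le mult_left_mono order_trans)
  then have sq: "(p * 0.95)\<^sup>2 \<le> (sin p)\<^sup>2"
    using p by (intro power_mono) auto
  \<comment> \<open>The constant fits from both sides: 0.95 * 3.14 > 2.97, and 2 * (2.97 / 4)^2 >
    1.\<close>
  have "2.97 / 4 / (real D + 1) \<le> p * 0.95"
    using mult_right_mono[of "3.14" pi "real D + 1"] pi_approx by (simp add: p_def field_simps)
  then have "(2.97 / 4 / (real D + 1))\<^sup>2 \<le> (p * 0.95)\<^sup>2"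
    by (intro power_mono) auto
  moreover have "1 / (real D + 1)\<^sup>2 \<le> 2 * (2.97 / 4 / (real D + 1))\<^sup>2"
    unfolding power_divide times_divide_eq_right
    by (intro divide_right_mono) (auto simp: power2_eq_square)
  ultimately have "1 / (real D + 1)\<^sup>2 \<le> 2 * (sin p)\<^sup>2"
    using sq by linarith
  moreover have "cos (pi / (2 * D + 1)) = 1 - 2 * (sin p)\<^sup>2"
  proof -
    have "pi / (2 * D + 1) = 2 * p"
      by (simp add: p_def field_simps)
    then show ?thesis
      by (simp add: cos_double_sin)
  qed
  ultimately show ?thesis
    using exp_ge_add_one_self[of "- 1 / (real D + 1)\<^sup>2"] by linarith
qed

text \<open>The prefactor is at most 2 exp (- y), so it supplies one extra unit in the exponent.
  That unit later pays for rounding the number of rounds down.\<close>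

lemma survival_le_exp:
  assumes "D \<ge> 1"
  shows "survival D r D \<le> 2 * exp (- (real r + 1) / (real D + 1)\<^sup>2)"
proof -
  define t where "t = pi / (2 * D + 1)"
  define y where "y = 1 / (real D + 1)\<^sup>2"
  have t: "0 < t" "t \<le> pi / 2"
    using assms by (auto simp: t_def field_simps)
  have "D * (2 * sin (t / 2)) \<le> D * t"
    using sin_x_le_x[of "t / 2"] t by (intro mult_left_mono) auto
  also have "\<dots> \<le> 2 * (1 - y)"
  proof -
    \<comment> \<open>Even with pi replaced by 4, the two polynomials differ by 2 D^2 in the right
      direction.\<close>
    have "pi * (D * (real D + 1)\<^sup>2) \<le> 4 * (D * (real D + 1)\<^sup>2)"
      using pi_less_4 by (intro mult_right_mono) auto
    also have "\<dots> \<le> 2 * (2 * real D + 1) * ((real D + 1)\<^sup>2 - 1)"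
      using assms by (simp add: power2_eq_square algebra_simps)
    finally show ?thesis
      by (simp add: t_def y_def field_simps)
  qed
  also have "\<dots> \<le> 2 * exp (- y)"
    using exp_ge_add_one_self[of "- y"] by simp
  finally have 1: "D * (2 * sin (t / 2)) \<le> 2 * exp (- y)" .
  have cos: "0 \<le> cos t" "cos t \<le> exp (- y)"
    using cos_ge_zero[of t] cos_le_exp[OF assms] t unfolding t_def[symmetric] y_def by auto
  then have "cos t ^ r \<le> exp (- y) ^ r"
    by (intro power_mono)
  then have "D * (2 * sin (t / 2)) * cos t ^ r \<le> 2 * exp (- y) * exp (- y) ^ r"
    using cos by (intro mult_mono[OF 1]) auto
  also have "\<dots> = 2 * exp (- (real r + 1) * y)"
    by (simp add: exp_of_nat_mult[symmetric] exp_add[symmetric] algebra_simps)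
  finally show ?thesis
    using survival_le_cos_power[OF assms, of r] by (simp add: t_def y_def)
qed

section \<open>Distances as walk lengths, and the diameter\<close>

definition edge_dist :: "('a, 'b) pre_digraph \<Rightarrow> 'a \<Rightarrow> 'a \<Rightarrow> nat" where
  "edge_dist G u v = (LEAST k. \<exists>p. pre_digraph.awalk G u p v \<and> length p = k)"

context wf_digraph
begin

lemma awalk_cost_one: "awalk_cost (\<lambda>_. 1) p = real (length p)"
  by (induction p) auto

lemma edge_dist_le: "awalk u p v \<Longrightarrow> edge_dist G u v \<le> length p"
  unfolding edge_dist_def by (rule Least_le) blast

lemma edge_dist_awalkE:
  assumes "u \<rightarrow>\<^sup>*\<^bsub>G\<^esub> v"
  obtains p where "awalk u p v" "length p = edge_dist G u v"
proof -
  from assms obtain p where "awalk u p v"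
    by (auto simp: reachable_awalk)
  then have "\<exists>k p. awalk u p v \<and> length p = k"
    by blast
  from LeastI_ex[OF this] that show thesis
    unfolding edge_dist_def by blast
qed

text \<open>Unit costs make the cost of a walk its length. Reachability matters: without a walk
  \<open>graph_dist\<close> is infinite, while the \<open>LEAST\<close> in \<open>edge_dist\<close>
  is unspecified.\<close>

lemma graph_dist_eq_edge_dist:
  assumes "u \<rightarrow>\<^sup>*\<^bsub>G\<^esub> v"
  shows "graph_dist G u v = ereal (edge_dist G u v)"
proof (rule antisym)
  obtain p where "awalk u p v" "length p = edge_dist G u v"
    using assms by (rule edge_dist_awalkE)
  then show "graph_dist G u v \<le> ereal (edge_dist G u v)"
    using min_cost_le_walk_cost[of u p v "\<lambda>_. 1"] by (simp add: graph_dist_def awalk_cost_one)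
  show "ereal (edge_dist G u v) \<le> graph_dist G u v"
    unfolding graph_dist_def \<mu>_def by (rule INF_greatest) (auto simp: awalk_cost_one edge_dist_le)
qed

lemma edge_dist_eq_0_iff:
  assumes "u \<rightarrow>\<^sup>*\<^bsub>G\<^esub> v"
  shows "edge_dist G u v = 0 \<longleftrightarrow> u = v"
proof
  assume "edge_dist G u v = 0"
  with edge_dist_awalkE[OF assms] show "u = v"
    by (metis awalk_Nil_iff length_0_conv)
next
  assume "u = v"
  with assms have "awalk u [] v"
    by (auto simp: awalk_Nil_iff reachable_in_verts)
  then show "edge_dist G u v = 0"
    using edge_dist_le by fastforce
qed

lemma edge_dist_adj_le:
  assumes "u \<rightarrow>\<^bsub>G\<^esub> w" "w \<rightarrow>\<^sup>*\<^bsub>G\<^esub> v"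
  shows "edge_dist G u v \<le> Suc (edge_dist G w v)"
proof -
  obtain p where p: "awalk w p v" "length p = edge_dist G w v"
    using assms(2) by (rule edge_dist_awalkE)
  obtain e where "e \<in> arcs G" "tail G e = u" "head G e = w"
    using assms(1) by auto
  then have "awalk u (e # p) v"
    using p by (auto simp: awalk_Cons_iff)
  from edge_dist_le[OF this] p show ?thesis
    by simp
qed

text \<open>The first step of a shortest walk leads to such a neighbour.\<close>

lemma edge_dist_step:
  assumes "u \<rightarrow>\<^sup>*\<^bsub>G\<^esub> v" "u \<noteq> v"
  obtains w where "u \<rightarrow>\<^bsub>G\<^esub> w" "Suc (edge_dist G w v) \<le> edge_dist G u v"
proof -
  obtain p where p: "awalk u p v" "length p = edge_dist G u v"
    using assms(1) by (rule edge_dist_awalkE)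
  with assms(2) obtain e q where q: "p = e # q"
    by (cases p) (auto simp: awalk_Nil_iff)
  with p have "e \<in> arcs G" "tail G e = u" "awalk (head G e) q v"
    by (auto simp: awalk_Cons_iff)
  then show thesis
    using p q edge_dist_le[of "head G e" q v] by (intro that[of "head G e"]) (auto simp: in_arcs_imp_in_arcs_ends)
qed

end

text \<open>Every arc has a reverse arc, so a walk can be turned around arc by arc; hence distances
  are symmetric.\<close>

lemma (in sym_digraph) awalk_reverse:
  assumes "awalk u p v"
  shows "\<exists>q. awalk v q u \<and> length q = length p"
  using assms
proof (induction p arbitrary: u)
  case (Cons e p)
  then have e: "e \<in> arcs G" "tail G e = u" and "awalk (head G e) p v"
    by (auto simp: awalk_Cons_iff)
  with Cons.IH obtain q where q: "awalk v q (head G e)" "length q = length p"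
    by blast
  have "head G e \<rightarrow>\<^bsub>G\<^esub> u"
    using e by (metis graph_symmetric in_arcs_imp_in_arcs_ends)
  then obtain e' where "arc e' (head G e, u)"
    by (auto simp: arc_def arcs_ends_conv)
  then have "awalk (head G e) [e'] u"
    using arc_implies_awalk[of e'] by (auto elim: arcE)
  with q have "awalk v (q @ [e']) u"
    by (meson awalk_appendI)
  with q show ?case
    by (intro exI[of _ "q @ [e']"]) auto
qed (auto simp: awalk_Nil_iff)

lemma (in sym_digraph) edge_dist_commute: "edge_dist G u v = edge_dist G v u"
  unfolding edge_dist_def by (rule arg_cong[where f = Least]) (metis awalk_reverse)

text \<open>\<open>Max\<close> commutes with the monotone embedding of the naturals into
  \<open>ereal\<close>, so the diameter is a natural number and can be the right end of the
  walk.\<close>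

lemma (in fin_digraph) graph_diam_eq:
  assumes "strongly_connected G"
  obtains D where "graph_diam G = real D"
    and "\<And>u v. u \<in> verts G \<Longrightarrow> v \<in> verts G \<Longrightarrow> edge_dist G u v \<le> D"
proof -
  define E where "E = (\<lambda>(u, v). edge_dist G u v) ` (verts G \<times> verts G)"
  have E: "finite E" "E \<noteq> {}"
    using assms by (auto simp: E_def strongly_connected_def)
  have "{graph_dist G u v | u v. u \<in> verts G \<and> v \<in> verts G} =
      (\<lambda>(u, v). graph_dist G u v) ` (verts G \<times> verts G)"
    by auto
  also have "\<dots> = (\<lambda>k. ereal (real k)) ` E"
    unfolding E_def image_image using assms
    by (intro image_cong) (auto simp: graph_dist_eq_edge_dist strongly_connected_def)
  finally have "graph_diam G = real_of_ereal (Max ((\<lambda>k. ereal (real k)) ` E))"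
    by (simp add: graph_diam_def)
  also have "Max ((\<lambda>k. ereal (real k)) ` E) = ereal (real (Max E))"
    using E by (intro mono_Max_commute[symmetric]) (auto simp: mono_def)
  finally show thesis
    using E by (intro that[of "Max E"]) (auto simp: E_def intro!: Max_ge)
qed

section \<open>Round robin schedules and contraction over one round\<close>

lemma round_robin_in_verts:
  assumes "round_robin G v" "card (verts G) > 0" "i \<ge> 1"
  shows "v i \<in> verts G"
  using assms(3)
proof (induction i rule: less_induct)
  case (less i)
  show ?case
  proof (cases "i \<le> card (verts G)")
    case True
    with less.prems assms(1) show ?thesis
      by (auto simp: round_robin_def bij_betw_def)
  next
    case False
    then have "v (i - card (verts G)) \<in> verts G"
      using assms(2) by (intro less.IH) auto
    moreover have "v (i - card (verts G) + card (verts G)) = v (i - card (verts G))"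
      using assms(1) False unfolding round_robin_def
      by (elim conjE allE[of _ "i - card (verts G)"]) auto
    ultimately show ?thesis
      using False by simp
  qed
qed

text \<open>Shifting the window by one drops the index \<open>t + 1\<close> but adds the index one
  period later, where the same vertex is updated.\<close>

lemma round_robin_hits:
  assumes "round_robin G v" "x \<in> verts G"
  shows "\<exists>i\<in>{t + 1..t + card (verts G)}. v i = x"
proof (induction t)
  case 0
  then show ?case
    using assms unfolding round_robin_def bij_betw_def by (metis add_0 imageE)
next
  case (Suc t)
  then obtain i where i: "i \<in> {t + 1..t + card (verts G)}" "v i = x"
    by blast
  show ?case
  proof (cases "i = t + 1")
    case True
    have "v (i + card (verts G)) = x"
      using assms(1) i unfolding round_robin_def by auto
    then show ?thesis
      using i True by (intro bexI[of _ "i + card (verts G)"]) auto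
  qed (use i in \<open>auto intro!: bexI[of _ i]\<close>)
qed

text \<open>A neighbour \<open>u\<close> closer to \<open>y\<close> has its value between the
  minimum and the maximum. The upper bound replaces the minimum by \<open>f u\<close>, the lower
  bound replaces the maximum; the other extreme obeys the far bound. The two distances match the
  recursion of \<open>survival\<close>.\<close>

lemma (in graph) survival_update:
  assumes conn: "strongly_connected G"
    and diam: "\<And>u v. u \<in> verts G \<Longrightarrow> v \<in> verts G \<Longrightarrow> edge_dist G u v \<le> D"
    and f: "\<And>u v. u \<in> verts G \<Longrightarrow> v \<in> verts G \<Longrightarrow> \<bar>f u - f v\<bar> \<le> survival D r (edge_dist G u v)"
    and xy: "x \<in> verts G" "y \<in> verts G" "x \<noteq> y"
  shows "\<bar>(Max (f ` {u. x \<rightarrow>\<^bsub>G\<^esub> u}) + Min (f ` {u. x \<rightarrow>\<^bsub>G\<^esub> u})) / 2 - f y\<bar> \<le> survival D (Suc r) (edge_dist G x y)"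
proof -
  let ?N = "{u. x \<rightarrow>\<^bsub>G\<^esub> u}" and ?k = "edge_dist G x y"
  have reach: "u \<rightarrow>\<^sup>*\<^bsub>G\<^esub> w" if "u \<in> verts G" "w \<in> verts G" for u w
    using conn that by (auto simp: strongly_connected_def)
  obtain u where u: "u \<in> ?N" "Suc (edge_dist G u y) \<le> ?k"
    using edge_dist_step[of x y] reach xy by blast
  have N: "?N \<subseteq> verts G"
    by (auto simp: adj_in_verts)
  then have fin: "finite ?N"
    by (rule finite_subset) simp
  obtain a where a: "a \<in> ?N" "Max (f ` ?N) = f a"
    using Max_in[of "f ` ?N"] fin u(1) by blast
  obtain b where b: "b \<in> ?N" "Min (f ` ?N) = f b"
    using Min_in[of "f ` ?N"] fin u(1) by blast
  have ab: "f u \<le> f a" "f b \<le> f u"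
    unfolding a(2)[symmetric] b(2)[symmetric] using fin u by auto
  have near: "\<bar>f u - f y\<bar> \<le> survival D r (?k - 1)"
    using f[of u y] survival_mono[of "edge_dist G u y" "?k - 1" D r] u N xy by force
  have far: "\<bar>f w - f y\<bar> \<le> survival D r (min (?k + 1) D)" if "w \<in> ?N" for w
  proof -
    have w: "w \<in> verts G" "w \<rightarrow>\<^bsub>G\<^esub> x"
      using that N by (auto intro: graph_symmetric)
    \<comment> \<open>The arc back to \<open>x\<close> gives \<open>?k + 1\<close>, and the diameter
      gives the cap \<open>D\<close>, which is the holding rule of the walk.\<close>
    then have "edge_dist G w y \<le> min (?k + 1) D"
      using edge_dist_adj_le[of w x y] diam reach xy by auto
    with f[OF w(1) xy(2)] survival_mono show ?thesis
      by (meson order_trans)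
  qed
  have "?k \<noteq> 0"
    using u by auto
  then show ?thesis
    using near far[OF a(1)] far[OF b(1)] ab unfolding a(2) b(2)
    by (simp only: survival.simps if_False) (auto simp: abs_le_iff field_simps)
qed

text \<open>One round advances the walk by one step: every pair has an endpoint updated during the
  round, and later updates do not spoil the gain.\<close>

lemma (in graph) survival_round:
  assumes conn: "strongly_connected G"
    and diam: "\<And>u v. u \<in> verts G \<Longrightarrow> v \<in> verts G \<Longrightarrow> edge_dist G u v \<le> D"
    and rr: "round_robin G v"
    and f0: "\<And>x y. x \<in> verts G \<Longrightarrow> y \<in> verts G \<Longrightarrow> \<bar>f\<^sub>0 x - f\<^sub>0 y\<bar> \<le> 1"
    and "x \<in> verts G" "y \<in> verts G"
  shows "\<bar>lipschitz_learning G v f\<^sub>0 (r * card (verts G)) x - lipschitz_learning G v f\<^sub>0 (r * card (verts G)) y\<bar>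
    \<le> survival D r (edge_dist G x y)"
  using assms(5,6)
proof (induction r arbitrary: x y)
  case 0
  then show ?case
    using f0[of x y] conn by (auto simp: edge_dist_eq_0_iff strongly_connected_def)
next
  case (Suc r)
  let ?t = "r * card (verts G)"
  let ?F = "lipschitz_learning G v f\<^sub>0"
  \<comment> \<open>Invariant inside a round: all pairs keep level \<open>r\<close>, as the next
    update requires, and pairs already touched satisfy level \<open>Suc r\<close>.\<close>
  have "\<bar>?F (?t + j) x - ?F (?t + j) y\<bar> \<le> survival D r (edge_dist G x y) \<and>
      (x \<in> v ` {?t + 1..?t + j} \<or> y \<in> v ` {?t + 1..?t + j} \<longrightarrow>
        \<bar>?F (?t + j) x - ?F (?t + j) y\<bar> \<le> survival D (Suc r) (edge_dist G x y))"
    if "x \<in> verts G" "y \<in> verts G" for j x y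
    using that
  proof (induction j arbitrary: x y)
    case 0
    with Suc.IH show ?case by simp
  next
    case (Suc j)
    define z where "z = v (Suc (?t + j))"
    have z: "z \<in> verts G"
      using round_robin_in_verts[OF rr] Suc.prems by (auto simp: z_def card_gt_0_iff)
    have step: "?F (?t + Suc j) = (?F (?t + j))(z := (Max (?F (?t + j) ` {u. z \<rightarrow>\<^bsub>G\<^esub> u}) + Min (?F (?t + j) ` {u. z \<rightarrow>\<^bsub>G\<^esub> u})) / 2)"
      by (simp add: z_def Let_def)
    have other: "?F (?t + Suc j) w = ?F (?t + j) w" if "w \<noteq> z" for w
      using that unfolding step by simp
    have image: "v ` {?t + 1..?t + Suc j} = insert z (v ` {?t + 1..?t + j})"
      by (simp add: z_def atLeastAtMostSuc_conv)
    have upd: "\<bar>?F (?t + Suc j) z - ?F (?t + j) w\<bar> \<le> survival D (Suc r) (edge_dist G z w)"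
      if "w \<in> verts G" "w \<noteq> z" for w
      using survival_update[OF conn diam, of "?F (?t + j)" r z w] Suc.IH z that
      unfolding step by auto
    consider "x = y" | "x \<noteq> y" "z = x" | "x \<noteq> y" "z = y" | "z \<noteq> x" "z \<noteq> y"
      by blast
    then show ?case
    proof cases
      case 1
      then show ?thesis by (simp add: survival_nonneg del: survival.simps)
    next
      case 2
      then have "\<bar>?F (?t + Suc j) x - ?F (?t + Suc j) y\<bar> \<le> survival D (Suc r) (edge_dist G x y)"
        using upd[of y] other[of y] Suc.prems by metis
      then show ?thesis
        using survival_Suc_le order_trans by blast
    next
      case 3
      then have "\<bar>?F (?t + Suc j) x - ?F (?t + Suc j) y\<bar> \<le> survival D (Suc r) (edge_dist G x y)"
        using upd[of x] other[of x] Suc.prems edge_dist_commute[of x y] abs_minus_commute by metis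
      then show ?thesis
        using survival_Suc_le order_trans by blast
    next
      case 4
      then show ?thesis
        using Suc.IH[OF Suc.prems] other[of x] other[of y] unfolding image by simp
    qed
  qed
  \<comment> \<open>After a full round \<open>x\<close> itself has been updated, so the stronger
    half applies.\<close>
  from this[of x y "card (verts G)"] round_robin_hits[OF rr, of x ?t] Suc.prems show ?case
    by (auto simp: add.commute simp del: survival.simps)
qed

section \<open>The bound on the hitting time\<close>

theorem proposition1p4:
  fixes G :: "('a, 'b) pre_digraph" and n :: nat
    and v :: "nat \<Rightarrow> 'a" and f\<^sub>0 :: "'a \<Rightarrow> real" and \<epsilon> :: real
  assumes "graph G" and "Digraph_Component.connected G"
    and "card (verts G) = n" and "n \<ge> 2"
    and "\<forall>x \<in> verts G. f\<^sub>0 x \<in> {0..1}"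
    and "round_robin G v"
    and "0 < \<epsilon>" and "\<epsilon> < 1"
  shows "ereal_of_enat (tau_infty G v f\<^sub>0 \<epsilon>) \<le> ereal (real n * (graph_diam G + 1)\<^sup>2 * ln (2 / \<epsilon>))"
proof -
  interpret graph G by fact
  have conn: "strongly_connected G"
    using assms(2) symmetric_connected_imp_strongly_connected sym_arcs by blast
  obtain D where D: "graph_diam G = real D"
    and diam: "\<And>u v. u \<in> verts G \<Longrightarrow> v \<in> verts G \<Longrightarrow> edge_dist G u v \<le> D"
    using graph_diam_eq[OF conn] by blast
  obtain x y where xy: "x \<in> verts G" "y \<in> verts G" "x \<noteq> y"
    using assms(3,4) card_le_Suc0_iff_eq[of "verts G"] by auto
  have "D \<ge> 1"
    using diam[OF xy(1,2)] edge_dist_eq_0_iff[of x y] conn xy by (auto simp: strongly_connected_def)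
  define L where "L = (real D + 1)\<^sup>2 * ln (2 / \<epsilon>)"
  \<comment> \<open>Rounding down keeps \<open>r * n\<close> within the claimed time; the lost
    fraction is covered by the \<open>real r + 1\<close> in \<open>survival_le_exp\<close>.\<close>
  define r where "r = nat \<lfloor>L\<rfloor>"
  have "L \<ge> 0"
    using assms(7,8) by (simp add: L_def)
  then have r: "real r \<le> L" "L \<le> real r + 1"
    unfolding r_def by linarith+
  have "ln (2 / \<epsilon>) \<le> (real r + 1) / (real D + 1)\<^sup>2"
    using r(2) by (simp add: L_def field_simps)
  then have "exp (- (real r + 1) / (real D + 1)\<^sup>2) \<le> exp (- ln (2 / \<epsilon>))"
    unfolding exp_le_cancel_iff minus_divide_left[symmetric] by simp
  also have "\<dots> = \<epsilon> / 2"
    using assms(7) by (simp add: exp_minus)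
  finally have eps: "survival D r D \<le> \<epsilon>"
    using survival_le_exp[OF \<open>D \<ge> 1\<close>, of r] by linarith
  let ?F = "lipschitz_learning G v f\<^sub>0 (r * n)"
  have "\<bar>f\<^sub>0 x - f\<^sub>0 y\<bar> \<le> 1" if "x \<in> verts G" "y \<in> verts G" for x y
    using bspec[OF assms(5) that(1)] bspec[OF assms(5) that(2)] by (simp add: abs_le_iff)
  \<comment> \<open>Monotonicity in the starting point replaces every distance by the worst case
    \<open>D\<close>.\<close>
  then have F: "?F x - ?F y \<le> \<epsilon>" if "x \<in> verts G" "y \<in> verts G" for x y
    using survival_round[OF conn diam assms(6), of f\<^sub>0 x y r] that
      survival_mono[OF diam[OF that], of D r] eps assms(3) by auto
  have ne: "?F ` verts G \<noteq> {}"
    using xy by auto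
  obtain a where "a \<in> verts G" "Max (?F ` verts G) = ?F a"
    using Max_in[OF _ ne] by auto
  moreover obtain b where "b \<in> verts G" "Min (?F ` verts G) = ?F b"
    using Min_in[OF _ ne] by auto
  ultimately have "oscillation G ?F \<le> \<epsilon>"
    using F by (simp add: oscillation_def)
  then have "tau_infty G v f\<^sub>0 \<epsilon> \<le> enat (r * n)"
    unfolding tau_infty_def by (intro INF_lower) auto
  then have "ereal_of_enat (tau_infty G v f\<^sub>0 \<epsilon>) \<le> ereal_of_enat (enat (r * n))"
    by (simp only: ereal_of_enat_le_iff)
  also have "\<dots> = ereal (real r * real n)"
    by simp
  also have "\<dots> \<le> ereal (real n * (graph_diam G + 1)\<^sup>2 * ln (2 / \<epsilon>))"
    using mult_left_mono[OF r(1), of "real n"] by (simp add: L_def D mult_ac)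
  finally show ?thesis .
qed

end
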